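(* Fix $t\in\mathbb{N}_0$. Let $X_N=(\theta_1,\ldots,\theta_N,\phi_1,\ldots,\phi_N)$ with $(\theta_i,\phi_i)\in[0,\pi]\times[0,2\pi)$ and $\bm{x}_i=\bm{x}(\theta_i,\phi_i)\in\mathbb{S}^2$, let $$A_{N,t}(X_N)=\frac{4\pi}{N^2}\sum_{(\ell,m)\in\mathcal{I}_t}\Big|\sum_{i=1}^N Y_\ell^m(\theta_i,\phi_i)\Big|^2-1,$$ and define $$\hat c_\ell^m=\sum_{i=1}^N\overline{Y_\ell^m(\bm{x}_i)},\qquad a_\ell^m=\sqrt{\frac{\ell^2[(\ell+1)^2-m^2]}{(2\ell+1)(2\ell+3)}},\qquad b_\ell^m=\sqrt{\frac{(\ell+1)^2(\ell^2-m^2)}{(2\ell-1)(2\ell+1)}}$$ for $(\ell,m)\in\mathcal{I}_{t+2}$, with the convention $a_{-1}^m=b_{t+1}^m=b_{t+2}^m=0$. Define vectors $\hat{\bm{c}}_0\in\mathbb{C}^{(t+2)^2}$, $\hat{\bm{d}}_0\in\mathbb{C}^{(t+1)^2}$ and a diagonal matrix $\bm{D}_{\bm\theta}$ by $$\hat{\bm{c}}_0=\frac{8\pi}{N^2}\big(\hat c_{\ell-1}^m a_{\ell-1}^m-\hat c_{\ell+1}^m b_{\ell+1}^m\big)_{(\ell,m)\in\mathcal{I}_{t+1}},\qquad \hat{\bm{d}}_0=\frac{8\pi}{N^2}\big(\mathrm{i}\,m\,\hat c_\ell^m\big)_{(\ell,m)\in\mathcal{I}_t},\qquad \bm{D}_{\bm\theta}=\mathrm{diag}\Big(\frac{1}{\sin\theta_1},\ldots,\frac{1}{\sin\theta_N}\Big).$$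 Then $A_{N,t}$ and its gradient $\nabla A_{N,t}$ (with respect to the $2N$ variables $\theta_1,\ldots,\theta_N,\phi_1,\ldots,\phi_N$) are given in matrix-vector form by $$A_{N,t}(X_N)=\frac{4\pi}{N^2}\|\bm{Y}_t^\star\bm{e}\|^2-1,\qquad \nabla A_{N,t}(X_N)=\mathrm{Re}\begin{bmatrix}\bm{D}_{\bm\theta}\bm{Y}_{t+1}\hat{\bm{c}}_0\\ \bm{Y}_t\hat{\bm{d}}_0\end{bmatrix}.$$
   Context: For $(\theta,\phi)\in[0,\pi]\times[0,2\pi)$, $\bm{x}(\theta,\phi)=(\sin\theta\cos\phi,\sin\theta\sin\phi,\cos\theta)\in\mathbb{S}^2$, the unit sphere in $\mathbb{R}^3$. The spherical harmonics are $$Y_\ell^m(\bm{x})=Y_\ell^m(\theta,\phi)=\sqrt{\frac{2\ell+1}{4\pi}\frac{(\ell-m)!}{(\ell+m)!}}\,P_\ell^m(\cos\theta)e^{\mathrm{i}m\phi},\qquad \ell\in\mathbb{N}_0,\ -\ell\le m\le\ell,$$ where $P_\ell(z)=\frac{1}{2^\ell\ell!}\frac{d^\ell}{dz^\ell}[(z^2-1)^\ell]$, $P_\ell^m(z)=(-1)^m(1-z^2)^{m/2}\frac{d^m}{dz^m}P_\ell(z)$ for $0\le m\le\ell$, and $P_\ell^{-m}=(-1)^m\frac{(\ell-m)!}{(\ell+m)!}P_\ell^m$. Index set: $\mathcal{I}_t=\{(\ell,m):\ell=0,\ldots,t;\ m=-\ell,\ldots,\ell\}$, which has $(t+1)^2$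 elements. (In $\hat{\bm c}_0$, for $|m|=\ell$ the formula for $a_{\ell-1}^m$ gives $0$, so the term $\hat c_{\ell-1}^m a_{\ell-1}^m$ is $0$.) $\bm{Y}_t=\bm{Y}_t(X_N)=(Y_\ell^m(\bm{x}_i))_{i=1,\ldots,N;\,(\ell,m)\in\mathcal{I}_t}\in\mathbb{C}^{N\times(t+1)^2}$ (rows indexed by points, columns by $(\ell,m)$), and $\bm{Y}_t^\star$ is its conjugate transpose. $\bm{e}=[1,\ldots,1]^\top$ is the all-ones vector of size $N$, $\mathrm{Re}$ denotes the entrywise real part, and $\|\cdot\|$ is the Euclidean norm. *)

theory Defs
  imports "HOL-Analysis.Analysis"
begin

definition legendre_P :: "nat \<Rightarrow> real \<Rightarrow> real" where
  "legendre_P l z = 1 / (2 ^ l * fact l) * (deriv ^^ l) (\<lambda>x. (x\<^sup>2 - 1) ^ l) z"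

text \<open>
  The factor \<open>(1 - z\<^sup>2) powr (m / 2)\<close> is written \<open>sqrt (1 - z\<^sup>2) ^ m\<close>, because
  \<open>0 powr 0 = 0\<close> would give the wrong value for \<open>m = 0\<close> at the poles \<open>z = 1\<close> and \<open>z = -1\<close>.
\<close>

definition assoc_legendre_nonneg :: "nat \<Rightarrow> nat \<Rightarrow> real \<Rightarrow> real" where
  "assoc_legendre_nonneg l m z = (-1) ^ m * sqrt (1 - z\<^sup>2) ^ m * (deriv ^^ m) (legendre_P l) z"

definition assoc_legendre :: "nat \<Rightarrow> int \<Rightarrow> real \<Rightarrow> real" where
  "assoc_legendre l m z =
     (if 0 \<le> m then assoc_legendre_nonneg l (nat m) z
      else (-1) ^ nat (- m) * (fact (l - nat (- m)) / fact (l + nat (- m)))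
             * assoc_legendre_nonneg l (nat (- m)) z)"

text \<open>Only meaningful for \<open>- int l \<le> m \<le> int l\<close>; otherwise the factorials are truncated.\<close>

definition sph_harm :: "nat \<Rightarrow> int \<Rightarrow> real \<Rightarrow> real \<Rightarrow> complex" where
  "sph_harm l m \<theta> \<phi> =
     complex_of_real
       (sqrt ((2 * real l + 1) / (4 * pi) * (fact (nat (int l - m)) / fact (nat (int l + m))))
         * assoc_legendre l m (cos \<theta>))
     * exp (\<i> * of_int m * complex_of_real \<phi>)"

definition harm_index :: "nat \<Rightarrow> (nat \<times> int) set" where
  "harm_index t = {(l, m). l \<le> t \<and> - int l \<le> m \<and> m \<le> int l}"

text \<open>
  A point configuration is a pair \<open>(\<theta>, \<phi>)\<close> of vectors in \<open>real ^ 'n\<close>, with \<open>N = CARD('n)\<close>;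
  thus the space of the \<open>2 N\<close> variables is the Euclidean space \<open>(real ^ 'n) \<times> (real ^ 'n)\<close>.
\<close>

definition A_fun :: "nat \<Rightarrow> (real ^ 'n) \<times> (real ^ 'n) \<Rightarrow> real" where
  "A_fun t X =
     4 * pi / (real CARD('n))\<^sup>2
       * (\<Sum>(l, m)\<in>harm_index t. (cmod (\<Sum>i\<in>UNIV. sph_harm l m (fst X $ i) (snd X $ i)))\<^sup>2) - 1"

definition c_hat :: "(real ^ 'n) \<times> (real ^ 'n) \<Rightarrow> nat \<Rightarrow> int \<Rightarrow> complex" where
  "c_hat X l m = (\<Sum>i\<in>UNIV. cnj (sph_harm l m (fst X $ i) (snd X $ i)))"

definition a_coef :: "int \<Rightarrow> int \<Rightarrow> real" where
  "a_coef l m =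
     (if l = - 1 then 0
      else sqrt ((of_int l)\<^sup>2 * ((of_int l + 1)\<^sup>2 - (of_int m)\<^sup>2)
                 / ((2 * of_int l + 1) * (2 * of_int l + 3))))"

text \<open>The parameter \<open>t\<close> enters through the convention that \<open>b\<close> vanishes at \<open>t + 1\<close> and \<open>t + 2\<close>.\<close>

definition b_coef :: "nat \<Rightarrow> nat \<Rightarrow> int \<Rightarrow> real" where
  "b_coef t l m =
     (if l = t + 1 \<or> l = t + 2 then 0
      else sqrt ((real l + 1)\<^sup>2 * ((real l)\<^sup>2 - (of_int m)\<^sup>2)
                 / ((2 * real l - 1) * (2 * real l + 1))))"

text \<open>
  Vectors and matrices indexed by the finite set \<open>harm_index t\<close> are library vectors and matrices
  over a finite index type \<open>'p\<close>, together with an enumeration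
  \<open>\<iota> :: 'p \<Rightarrow> nat \<times> int\<close>; the theorem assumes \<open>\<iota>\<close> to be a bijection from
  \<open>'p\<close> onto the index set.
\<close>

definition Y_mat :: "('p \<Rightarrow> nat \<times> int) \<Rightarrow> (real ^ 'n) \<times> (real ^ 'n) \<Rightarrow> complex ^ 'p ^ 'n" where
  "Y_mat \<iota> X = (\<chi> i p. case \<iota> p of (l, m) \<Rightarrow> sph_harm l m (fst X $ i) (snd X $ i))"

definition conj_transpose :: "complex ^ 'p ^ 'n \<Rightarrow> complex ^ 'n ^ 'p" where
  "conj_transpose M = (\<chi> p i. cnj (M $ i $ p))"

text \<open>
  For \<open>l = 0\<close> the degree \<open>l - 1\<close> in \<open>c_hat\<close> is truncated, and for \<open>\<bar>m\<bar> = l\<close> the pair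
  \<open>(l - 1, m)\<close> is not an admissible index; in both cases the factor \<open>a_coef\<close> is \<open>0\<close>.
\<close>

definition c0_vec ::
  "nat \<Rightarrow> ('q \<Rightarrow> nat \<times> int) \<Rightarrow> (real ^ 'n) \<times> (real ^ 'n) \<Rightarrow> complex ^ 'q" where
  "c0_vec t \<kappa> X =
     (\<chi> q. case \<kappa> q of (l, m) \<Rightarrow>
        complex_of_real (8 * pi / (real CARD('n))\<^sup>2)
          * (c_hat X (l - 1) m * complex_of_real (a_coef (int l - 1) m)
             - c_hat X (l + 1) m * complex_of_real (b_coef t (l + 1) m)))"

definition d0_vec :: "('p \<Rightarrow> nat \<times> int) \<Rightarrow> (real ^ 'n) \<times> (real ^ 'n) \<Rightarrow> complex ^ 'p" where
  "d0_vec \<iota> X =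
     (\<chi> p. case \<iota> p of (l, m) \<Rightarrow>
        complex_of_real (8 * pi / (real CARD('n))\<^sup>2) * (\<i> * of_int m * c_hat X l m))"

definition D_mat :: "real ^ 'n \<Rightarrow> complex ^ 'n ^ 'n" where
  "D_mat \<theta> = (\<chi> i j. if i = j then complex_of_real (1 / sin (\<theta> $ i)) else 0)"

definition Re_vec :: "complex ^ 'n \<Rightarrow> real ^ 'n" where
  "Re_vec v = (\<chi> i. Re (v $ i))"

end

theory Submission
  imports Defs
begin

text \<open>
  The heart of the matter is the relation
  \<open>sin \<theta> * (d/d\<theta>) Y(l, m) = a(l, m) * Y(l + 1, m) - b(l, m) * Y(l - 1, m)\<close>.
  Up to normalisation and a power of \<open>sin \<theta>\<close> it says that \<open>n z Q - (1 - z\<^sup>2) Q'\<close>, for \<open>Q\<close> the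
  \<open>n\<close>-th derivative of a Legendre polynomial, is a combination of the \<open>n\<close>-th derivatives of the two
  neighbouring Legendre polynomials. For \<open>n = 0\<close> this follows from Rodrigues' formula, and
  differentiation carries it from \<open>n\<close> to \<open>n + 1\<close>. Differentiating the squared moduli and
  shifting the degree in the resulting sums then gives the gradient; the boundary terms of the shift
  are absorbed by the conventions on \<open>a\<close> and \<open>b\<close> and by \<open>b(l, m) = 0\<close> for \<open>\<bar>m\<bar> = l\<close>.
\<close>

section \<open>Legendre polynomials and their three-term relations\<close>

text \<open>Rodrigues' formula as a formal polynomial, so that identities can be differentiated by
  \<open>pderiv\<close> without differentiability side conditions.\<close>

definition legendre_poly :: "nat \<Rightarrow> real poly" where
  "legendre_poly l = smult (1 / (2 ^ l * fact l)) ((pderiv ^^ l) ([:-1, 0, 1:] ^ l))"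

lemma higher_deriv_poly: "(deriv ^^ n) (poly p) = poly ((pderiv ^^ n) p)"
  for p :: "'a::real_normed_field poly"
proof (induction n)
  case (Suc n)
  have "deriv (poly q) = poly (pderiv q)" for q :: "'a poly"
    by (intro ext DERIV_imp_deriv poly_DERIV)
  with Suc show ?case by simp
qed simp

lemma legendre_P_eq_poly: "legendre_P l = poly (legendre_poly l)"
proof -
  have "(\<lambda>x::real. (x\<^sup>2 - 1) ^ l) = poly ([:-1, 0, 1:] ^ l)"
    by (intro ext) (simp add: power2_eq_square)
  then show ?thesis
    by (intro ext) (simp add: legendre_P_def legendre_poly_def higher_deriv_poly)
qed

text \<open>Leibniz rule for a product with the variable, whose second derivative vanishes, so only
  two terms survive.\<close>

lemma higher_pderiv_pCons_0:
  "(pderiv ^^ Suc n) (pCons 0 p)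
     = pCons 0 ((pderiv ^^ Suc n) p) + smult (of_nat (Suc n)) ((pderiv ^^ n) p)"
  for p :: "'a::{comm_semiring_1,semiring_no_zero_divisors} poly"
proof (induction n)
  case 0
  then show ?case by (simp add: pderiv_pCons add.commute)
next
  case (Suc n)
  have "(pderiv ^^ Suc (Suc n)) (pCons 0 p)
      = pderiv (pCons 0 ((pderiv ^^ Suc n) p) + smult (of_nat (Suc n)) ((pderiv ^^ n) p))"
    using Suc by simp
  also have "\<dots> = pCons 0 ((pderiv ^^ Suc (Suc n)) p) + smult (of_nat (Suc (Suc n))) ((pderiv ^^ Suc n) p)"
    by (simp add: pderiv_pCons pderiv_add pderiv_smult smult_add_left algebra_simps)
  finally show ?case .
qed

lemma higher_pderiv_pCons_0_pderiv:
  "(pderiv ^^ n) (pCons 0 (pderiv p))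
     = pCons 0 ((pderiv ^^ Suc n) p) + smult (of_nat n) ((pderiv ^^ n) p)"
  for p :: "'a::{comm_semiring_1,semiring_no_zero_divisors} poly"
proof (cases n)
  case (Suc k)
  then show ?thesis
    using higher_pderiv_pCons_0[of k "pderiv p"] by (simp add: funpow_swap1)
qed simp

lemma pderiv_x2_minus_1_power:
  "pderiv ([:-1, 0, 1:] ^ Suc l) = smult (2 * real (Suc l)) (pCons 0 ([:-1, 0, 1:] ^ l))"
proof -
  have "pderiv [:-1, 0, 1:] = (smult 2 [:0, 1:] :: real poly)"
    by (simp add: pderiv_pCons)
  then show ?thesis
    by (simp add: pderiv_power_Suc mult.commute del: power_Suc of_nat_Suc)
qed

lemma pderiv_legendre_poly:
  "pderiv (legendre_poly l) = smult (1 / (2 ^ l * fact l)) ((pderiv ^^ Suc l) ([:-1, 0, 1:] ^ l))"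
  by (simp add: legendre_poly_def pderiv_smult)

text \<open>One of the derivatives in Rodrigues' formula is spent on the power of z^2 - 1, which
  leaves z (z^2 - 1)^l times a constant; Leibniz handles the remaining l + 1 derivatives.\<close>

lemma pderiv_legendre_poly_Suc:
  "pderiv (legendre_poly (Suc l))
     = pCons 0 (pderiv (legendre_poly l)) + smult (real (Suc l)) (legendre_poly l)"
proof -
  let ?w = "[:-1, 0, 1:] :: real poly"
  \<comment> \<open>The factor from the chain rule cancels against the ratio of consecutive
    normalisations.\<close>
  have c: "1 / (2 ^ Suc l * fact (Suc l)) * (2 * real (Suc l)) = 1 / (2 ^ l * fact l)" for l
    by (simp add: divide_simps)
  have "(pderiv ^^ Suc (Suc l)) (?w ^ Suc l) = (pderiv ^^ Suc l) (pderiv (?w ^ Suc l))"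
    by (simp only: funpow_Suc_right o_apply)
  also have "\<dots> = smult (2 * real (Suc l))
      (pCons 0 ((pderiv ^^ Suc l) (?w ^ l)) + smult (real (Suc l)) ((pderiv ^^ l) (?w ^ l)))"
    unfolding pderiv_x2_minus_1_power higher_pderiv_smult higher_pderiv_pCons_0 by simp
  finally have "pderiv (legendre_poly (Suc l)) =
     smult (1 / (2 ^ l * fact l)) (pCons 0 ((pderiv ^^ Suc l) (?w ^ l)) + smult (real (Suc l)) ((pderiv ^^ l) (?w ^ l)))"
    unfolding pderiv_legendre_poly by (simp only: smult_smult c)
  then show ?thesis
    unfolding pderiv_legendre_poly unfolding legendre_poly_def
    by (simp only: smult_add_right smult_smult smult_pCons mult_zero_left mult_zero_right mult.commute)
qed

text \<open>Here two derivatives are spent. The resulting z^2 is split as (z^2 - 1) + 1, so the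
  other l + 1 derivatives fall on pure powers of z^2 - 1 and Rodrigues' formula applies
  again.\<close>

lemma pderiv_legendre_poly_Suc_Suc:
  "pderiv (legendre_poly (Suc (Suc l)))
     = pderiv (legendre_poly l) + smult (2 * real l + 3) (legendre_poly (Suc l))"
proof -
  let ?w = "[:-1, 0, 1:] :: real poly"
  have "pCons 0 (pCons 0 (?w ^ l)) = ?w ^ Suc l + ?w ^ l"
    by simp
  then have 1: "pderiv (pderiv (?w ^ Suc (Suc l))) =
     smult (2 * real (Suc (Suc l))) (smult (2 * real l + 3) (?w ^ Suc l) + smult (2 * real (Suc l)) (?w ^ l))"
    by (simp only: pderiv_x2_minus_1_power pderiv_smult pderiv_pCons smult_pCons mult_zero_right)
      (rule poly_ext, simp add: algebra_simps)
  have c: "1 / (2 ^ Suc l * fact (Suc l)) * (2 * real (Suc l)) = 1 / (2 ^ l * fact l)" for l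
    by (simp add: divide_simps)
  have "(pderiv ^^ Suc (Suc (Suc l))) (?w ^ Suc (Suc l)) = (pderiv ^^ Suc l) (pderiv (pderiv (?w ^ Suc (Suc l))))"
    by (simp only: funpow_Suc_right o_apply)
  also have "\<dots> = smult (2 * real (Suc (Suc l)))
     (smult (2 * real l + 3) ((pderiv ^^ Suc l) (?w ^ Suc l)) + smult (2 * real (Suc l)) ((pderiv ^^ Suc l) (?w ^ l)))"
    unfolding 1 higher_pderiv_smult higher_pderiv_add by simp
  finally have "pderiv (legendre_poly (Suc (Suc l))) = smult (1 / (2 ^ Suc l * fact (Suc l)))
     (smult (2 * real l + 3) ((pderiv ^^ Suc l) (?w ^ Suc l)) + smult (2 * real (Suc l)) ((pderiv ^^ Suc l) (?w ^ l)))"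
    unfolding pderiv_legendre_poly by (simp only: smult_smult c)
  then show ?thesis
    unfolding pderiv_legendre_poly unfolding legendre_poly_def
    by (simp only: smult_add_right smult_smult c) (simp only: mult.commute add.commute)
qed

text \<open>
  The middle degree is \<open>Suc l\<close> rather than \<open>l\<close>, so that no truncated subtraction occurs.
\<close>

lemma x_pderiv_legendre_poly:
  "smult (2 * real l + 3) (pCons 0 (pderiv (legendre_poly (Suc l))))
     = smult (real l + 1) (pderiv (legendre_poly (Suc (Suc l))))
       + smult (real l + 2) (pderiv (legendre_poly l))" (is "?L = ?R")
proof (rule poly_ext)
  fix z
  show "poly ?L z = poly ?R z"
    using arg_cong[OF pderiv_legendre_poly_Suc[of "Suc l"], of "\<lambda>p. poly p z"]
      arg_cong[OF pderiv_legendre_poly_Suc_Suc[of l], of "\<lambda>p. poly p z"]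
    by simp algebra
qed

text \<open>Supplies the correction term in the induction step of
  \<open>x2_minus_1_higher_pderiv_legendre_poly\<close>.\<close>

lemma x_higher_pderiv_legendre_poly:
  "smult (2 * real l + 3)
      (pCons 0 ((pderiv ^^ Suc n) (legendre_poly (Suc l)))
         + smult (real n) ((pderiv ^^ n) (legendre_poly (Suc l))))
     = smult (real l + 1) ((pderiv ^^ Suc n) (legendre_poly (Suc (Suc l))))
       + smult (real l + 2) ((pderiv ^^ Suc n) (legendre_poly l))"
  using arg_cong[OF x_pderiv_legendre_poly[of l], of "pderiv ^^ n"]
  unfolding higher_pderiv_smult higher_pderiv_add higher_pderiv_pCons_0_pderiv
  by (simp add: funpow_swap1)

text \<open>(z^2 - 1) times the derivative is expressed once through the lower and once through the
  upper neighbour; a weighted sum of the two removes the middle polynomial.\<close>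

lemma x2_minus_1_pderiv_legendre_poly:
  "smult (2 * real l + 3) ([:-1, 0, 1:] * pderiv (legendre_poly (Suc l)))
     = smult ((real l + 1) * (real l + 2)) (legendre_poly (Suc (Suc l)) - legendre_poly l)"
  (is "?L = ?R")
proof (rule poly_ext)
  fix z
  define p p1 p2 d d1 d2 where
    "p = poly (legendre_poly l) z" and "p1 = poly (legendre_poly (Suc l)) z"
    and "p2 = poly (legendre_poly (Suc (Suc l))) z"
    and "d = poly (pderiv (legendre_poly l)) z" and "d1 = poly (pderiv (legendre_poly (Suc l))) z"
    and "d2 = poly (pderiv (legendre_poly (Suc (Suc l)))) z"
  note defs = this
  have 1: "d1 = z * d + (real l + 1) * p"
    using arg_cong[OF pderiv_legendre_poly_Suc[of l], of "\<lambda>p. poly p z"]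
    by (simp add: defs algebra_simps)
  have 2: "d2 = z * d1 + (real l + 2) * p1"
    using arg_cong[OF pderiv_legendre_poly_Suc[of "Suc l"], of "\<lambda>p. poly p z"]
    by (simp add: defs algebra_simps)
  have 3: "d2 = d + (2 * real l + 3) * p1"
    using arg_cong[OF pderiv_legendre_poly_Suc_Suc[of l], of "\<lambda>p. poly p z"]
    by (simp add: defs)
  \<comment> \<open>Both relations one degree higher, with the derivative of degree l + 3
    eliminated.\<close>
  have 4: "d1 = z * d2 - (real l + 2) * p2"
    using arg_cong[OF pderiv_legendre_poly_Suc[of "Suc (Suc l)"], of "\<lambda>p. poly p z"]
      arg_cong[OF pderiv_legendre_poly_Suc_Suc[of "Suc l"], of "\<lambda>p. poly p z"]
    by (simp add: defs algebra_simps)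
  have "(z\<^sup>2 - 1) * d1 = (real l + 1) * (z * p1 - p)"
    using 1 2 3 by algebra
  moreover have "(z\<^sup>2 - 1) * d1 = (real l + 2) * (p2 - z * p1)"
    using 2 4 by algebra
  \<comment> \<open>The weights l + 2 and l + 1 make the two z * p1 terms cancel.\<close>
  ultimately have "(2 * real l + 3) * ((z\<^sup>2 - 1) * d1) = (real l + 1) * (real l + 2) * (p2 - p)"
    by algebra
  then show "poly ?L z = poly ?R z"
    by (simp add: defs power2_eq_square algebra_simps)
qed

lemma x2_minus_1_higher_pderiv_legendre_poly:
  "smult (2 * real l + 3)
      (smult (real n) (pCons 0 ((pderiv ^^ n) (legendre_poly (Suc l))))
         + [:-1, 0, 1:] * (pderiv ^^ Suc n) (legendre_poly (Suc l)))
     = smult ((real l + 1) * (real l + 2 - real n)) ((pderiv ^^ n) (legendre_poly (Suc (Suc l))))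
       - smult ((real l + 2) * (real l + 1 + real n)) ((pderiv ^^ n) (legendre_poly l))"
proof (induction n)
  case 0
  then show ?case
    using x2_minus_1_pderiv_legendre_poly[of l] by (simp add: smult_diff_right mult.commute)
next
  case (Suc n)
  show ?case (is "?L = ?R")
  proof (rule poly_ext)
    fix z
    let ?x = "[:-1, 0, 1:] :: real poly"
    have x: "pderiv ?x = [:0, 2:]" by (simp add: pderiv_pCons)
    \<comment> \<open>The left side of the differentiated induction hypothesis exceeds that of the
      goal by exactly the left side of \<open>x_higher_pderiv_legendre_poly\<close>; subtracting
      that identity lowers the two coefficients on the right as required.\<close>
    show "poly ?L z = poly ?R z"
      using arg_cong[OF Suc, of "\<lambda>p. poly (pderiv p) z"]
        arg_cong[OF x_higher_pderiv_legendre_poly[of l n], of "\<lambda>p. poly p z"]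
      unfolding pderiv_smult pderiv_add pderiv_diff pderiv_mult x pderiv_pCons
      by simp algebra
  qed
qed


text \<open>Needed at \<open>\<bar>m\<bar> = l\<close>, where the lower neighbour has degree smaller
  than the order of differentiation.\<close>

lemma higher_pderiv_legendre_poly_eq_0:
  assumes "l < n"
  shows "(pderiv ^^ n) (legendre_poly l) = 0"
proof -
  have "degree (legendre_poly l) \<le> l"
    by (simp add: legendre_poly_def degree_higher_pderiv degree_power_eq)
  then show ?thesis
    using assms
    by (cases n) (auto simp: degree_higher_pderiv pderiv_eq_0_iff)
qed

section \<open>Polar factor and normalisation of the spherical harmonics\<close>

text \<open>The real factor depending on \<open>\<theta>\<close>, separated so that real
  differentiation applies to it.\<close>

definition sph_theta :: "nat \<Rightarrow> int \<Rightarrow> real \<Rightarrow> real" where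
  "sph_theta l m \<theta> =
     sqrt ((2 * real l + 1) / (4 * pi) * (fact (nat (int l - m)) / fact (nat (int l + m))))
       * assoc_legendre l m (cos \<theta>)"

lemma sph_harm_eq_sph_theta:
  "sph_harm l m \<theta> \<phi> = complex_of_real (sph_theta l m \<theta>) * exp (\<i> * of_int m * complex_of_real \<phi>)"
  by (simp add: sph_harm_def sph_theta_def)

definition sph_norm :: "nat \<Rightarrow> nat \<Rightarrow> real" where
  "sph_norm l n = sqrt ((2 * real l + 1) / (4 * pi) * (fact (l - n) / fact (l + n)))"

lemma sqrt_mult_divide_swap:
  assumes "0 < a" "0 < (b::real)"
  shows "sqrt (q * (b / a)) * (a / b) = sqrt (q * (a / b))"
proof -
  have "sqrt (q * (a / b)) = sqrt ((q * (b / a)) * (a / b)\<^sup>2)"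
    using assms by (simp add: power2_eq_square field_simps)
  also have "\<dots> = sqrt (q * (b / a)) * (a / b)"
    using assms by (simp only: real_sqrt_mult real_sqrt_abs) simp
  finally show ?thesis ..
qed

text \<open>Treats both signs of \<open>m\<close> at once. For negative \<open>m\<close> the
  factorial quotient outside the root inverts the one inside (\<open>sqrt_mult_divide_swap\<close>),
  so only the sign still depends on the sign of \<open>m\<close>.\<close>

lemma sph_theta_eq:
  assumes "\<bar>m\<bar> \<le> int l"
  shows "sph_theta l m \<theta> = (if 0 \<le> m then (-1) ^ nat m else 1) * sph_norm l (nat \<bar>m\<bar>)
           * \<bar>sin \<theta>\<bar> ^ nat \<bar>m\<bar> * poly ((pderiv ^^ nat \<bar>m\<bar>) (legendre_poly l)) (cos \<theta>)"
proof -
  have s: "sqrt (1 - (cos \<theta>)\<^sup>2) = \<bar>sin \<theta>\<bar>"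
    by (simp add: cos_squared_eq)
  note al = assoc_legendre_def assoc_legendre_nonneg_def legendre_P_eq_poly higher_deriv_poly s
  show ?thesis
  proof (cases "0 \<le> m")
    case True
    then obtain n where "m = int n" by (metis zero_le_imp_eq_int)
    moreover have "nat (int l - int n) = l - n" "nat (int l + int n) = l + n" by auto
    ultimately show ?thesis
      by (simp add: sph_theta_def al sph_norm_def)
  next
    case False
    then obtain n where m: "m = - int n" "n > 0"
      by (metis linorder_not_le nat_int neg_0_le_iff_le of_nat_0_less_iff nle_le zero_le_imp_eq_int
          minus_minus neg_less_0_iff_less)
    have n: "nat (int l - m) = l + n" "nat (int l + m) = l - n" using m by auto
    \<comment> \<open>The sign in the definition for negative order cancels the phase of the
      positive order.\<close>
    have "((-1) ^ n * (-1) ^ n :: real) = 1"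
      by (simp flip: power_mult_distrib)
    then have "sph_theta l m \<theta> =
       (sqrt ((2 * real l + 1) / (4 * pi) * (fact (l + n) / fact (l - n)))
          * (fact (l - n) / fact (l + n))) * \<bar>sin \<theta>\<bar> ^ n * poly ((pderiv ^^ n) (legendre_poly l)) (cos \<theta>)"
      unfolding sph_theta_def n using m by (simp add: al algebra_simps)
    also have "sqrt ((2 * real l + 1) / (4 * pi) * (fact (l + n) / fact (l - n)))
          * (fact (l - n) / fact (l + n)) = sph_norm l n"
      unfolding sph_norm_def by (rule sqrt_mult_divide_swap) simp_all
    finally show ?thesis using m by simp
  qed
qed

text \<open>Of the factors l + 1 - n and l + 1 + n of the radicand, the second cancels against the
  factorial ratio and the first becomes a square. This turns \<open>a_coef\<close> into the rational
  coefficient of the polynomial identity.\<close>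

lemma sqrt_mult_sph_norm_raise:
  assumes "n \<le> l"
  shows "sqrt ((real l)\<^sup>2 * ((real l + 1)\<^sup>2 - (real n)\<^sup>2) / ((2 * real l + 1) * (2 * real l + 3)))
           * sph_norm (Suc l) n
         = real l * (real l + 1 - real n) / (2 * real l + 1) * sph_norm l n"
proof -
  define N where "N = 2 * real l + 1"
  define F where "F = (fact (l - n) / fact (l + n) :: real)"
  have N: "N > 0" by (simp add: N_def)
  have f: "fact (Suc l - n) / fact (Suc l + n) = F * ((real l + 1 - real n) / (real l + 1 + real n))"
    using assms by (simp add: F_def Suc_diff_le of_nat_diff field_simps)
  have sq: "(real l + 1)\<^sup>2 - (real n)\<^sup>2 = (real l + 1 - real n) * (real l + 1 + real n)"
    by (simp add: power2_eq_square algebra_simps)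
  have pos: "real l + 1 - real n > 0" "real l + 1 + real n > 0" "N + 2 > 0"
    using assms N by auto
  have "(real l)\<^sup>2 * ((real l + 1)\<^sup>2 - (real n)\<^sup>2) / (N * (N + 2))
        * ((N + 2) / (4 * pi) * (F * ((real l + 1 - real n) / (real l + 1 + real n))))
     = (real l * (real l + 1 - real n) / N)\<^sup>2 * (N / (4 * pi) * F)"
    unfolding sq using pos N by (simp add: divide_simps power2_eq_square)
  then have "sqrt ((real l)\<^sup>2 * ((real l + 1)\<^sup>2 - (real n)\<^sup>2) / (N * (N + 2)))
        * sqrt ((N + 2) / (4 * pi) * (F * ((real l + 1 - real n) / (real l + 1 + real n))))
     = \<bar>real l * (real l + 1 - real n) / N\<bar> * sqrt (N / (4 * pi) * F)"
    by (metis real_sqrt_mult real_sqrt_abs)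
  moreover have "\<bar>real l * (real l + 1 - real n) / N\<bar> = real l * (real l + 1 - real n) / N"
    using pos N by simp
  moreover have "2 * real (Suc l) + 1 = N + 2" "2 * real l + 3 = N + 2" by (simp_all add: N_def)
  ultimately show ?thesis
    unfolding sph_norm_def f by (simp only: F_def N_def)
qed

text \<open>The counterpart for \<open>b_coef\<close>, where the roles of the two factors are
  exchanged.\<close>

lemma sqrt_mult_sph_norm_lower:
  assumes "n \<le> l"
  shows "sqrt ((real (Suc l) + 1)\<^sup>2 * ((real (Suc l))\<^sup>2 - (real n)\<^sup>2)
               / ((2 * real (Suc l) - 1) * (2 * real (Suc l) + 1)))
           * sph_norm l n
         = (real l + 2) * (real l + 1 + real n) / (2 * real l + 3) * sph_norm (Suc l) n"
proof -
  define N where "N = 2 * real l + 1"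
  define F where "F = (fact (Suc l - n) / fact (Suc l + n) :: real)"
  have N: "N > 0" by (simp add: N_def)
  have pos: "real l + 1 - real n > 0" "real l + 1 + real n > 0" "N + 2 > 0"
    using assms N by auto
  have f: "fact (l - n) / fact (l + n) = F * ((real l + 1 + real n) / (real l + 1 - real n))"
    using assms pos by (simp add: F_def Suc_diff_le of_nat_diff divide_simps add_ac)
  have l2: "real (Suc l) + 1 = real l + 2" by simp
  have sq: "(real (Suc l))\<^sup>2 - (real n)\<^sup>2 = (real l + 1 - real n) * (real l + 1 + real n)"
    by (simp add: power2_eq_square algebra_simps)
  have "(real (Suc l) + 1)\<^sup>2 * ((real (Suc l))\<^sup>2 - (real n)\<^sup>2) / (N * (N + 2))
        * (N / (4 * pi) * (F * ((real l + 1 + real n) / (real l + 1 - real n))))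
     = ((real l + 2) * (real l + 1 + real n) / (N + 2))\<^sup>2 * ((N + 2) / (4 * pi) * F)"
    unfolding sq l2 using pos N by (simp add: divide_simps power2_eq_square)
  then have "sqrt ((real (Suc l) + 1)\<^sup>2 * ((real (Suc l))\<^sup>2 - (real n)\<^sup>2) / (N * (N + 2)))
        * sqrt (N / (4 * pi) * (F * ((real l + 1 + real n) / (real l + 1 - real n))))
     = \<bar>(real l + 2) * (real l + 1 + real n) / (N + 2)\<bar> * sqrt ((N + 2) / (4 * pi) * F)"
    by (metis real_sqrt_mult real_sqrt_abs)
  moreover have "\<bar>(real l + 2) * (real l + 1 + real n) / (N + 2)\<bar> = (real l + 2) * (real l + 1 + real n) / (N + 2)"
    using pos by simp
  moreover have "2 * real (Suc l) + 1 = N + 2" "2 * real l + 3 = N + 2" "2 * real (Suc l) - 1 = N"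
    by (simp_all add: N_def)
  ultimately show ?thesis
    unfolding sph_norm_def f by (simp only: F_def N_def)
qed

text \<open>
  For \<open>l = 0\<close> the truncated degree \<open>l - 1\<close> is harmless, since then \<open>b_coef t l m = 0\<close>.
\<close>

lemma sin_sph_theta_recurrence:
  assumes "\<bar>m\<bar> \<le> int l" "l \<le> t" "0 < sin \<theta>"
  defines "n \<equiv> nat \<bar>m\<bar>"
  shows "(if 0 \<le> m then (-1) ^ nat m else 1) * sph_norm l n * sin \<theta> ^ n
           * (real n * cos \<theta> * poly ((pderiv ^^ n) (legendre_poly l)) (cos \<theta>)
               - (sin \<theta>)\<^sup>2 * poly ((pderiv ^^ Suc n) (legendre_poly l)) (cos \<theta>))
         = a_coef (int l) m * sph_theta (Suc l) m \<theta> - b_coef t l m * sph_theta (l - 1) m \<theta>"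
proof (cases l)
  case 0
  with assms have "m = 0" by simp
  moreover have "pderiv (legendre_poly 0) = 0" by (simp add: legendre_poly_def)
  ultimately show ?thesis using 0 assms by (simp add: a_coef_def b_coef_def)
next
  case (Suc k)
  define \<sigma> :: real where "\<sigma> = (if 0 \<le> m then (-1) ^ nat m else 1)"
  define q where "q j i = poly ((pderiv ^^ i) (legendre_poly j)) (cos \<theta>)" for i j
  have m2: "(real_of_int m)\<^sup>2 = (real n)\<^sup>2" by (simp add: n_def)
  have nl: "n \<le> l" using assms by (simp add: n_def)
  \<comment> \<open>The polynomial identity at z = cos \<open>\<theta>\<close>, where z^2 - 1 is
    minus the squared sine.\<close>
  have rec: "(2 * real k + 3) * (real n * cos \<theta> * q l n - (sin \<theta>)\<^sup>2 * q l (Suc n))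
     = (real k + 1) * (real k + 2 - real n) * q (Suc l) n
       - (real k + 2) * (real k + 1 + real n) * q k n"
    using arg_cong[OF x2_minus_1_higher_pderiv_legendre_poly[of k n], of "\<lambda>p. poly p (cos \<theta>)"]
    unfolding Suc q_def sin_squared_eq by (simp add: power2_eq_square algebra_simps)
  have up: "a_coef (int l) m * sph_theta (Suc l) m \<theta>
     = \<sigma> * sph_norm l n * sin \<theta> ^ n * ((real k + 1) * (real k + 2 - real n) / (2 * real k + 3) * q (Suc l) n)"
  proof -
    have "a_coef (int l) m * sph_norm (Suc l) n = (real k + 1) * (real k + 2 - real n) / (2 * real k + 3) * sph_norm l n"
      using sqrt_mult_sph_norm_raise[OF nl] m2 by (simp add: a_coef_def Suc add_ac)
    moreover have "sph_theta (Suc l) m \<theta> = sph_norm (Suc l) n * (\<sigma> * sin \<theta> ^ n * q (Suc l) n)"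
      using assms by (simp add: sph_theta_eq \<sigma>_def q_def)
    ultimately show ?thesis by (simp only: mult.assoc[symmetric]) (simp only: mult_ac)
  qed
  have down: "b_coef t l m * sph_theta (l - 1) m \<theta>
     = \<sigma> * sph_norm l n * sin \<theta> ^ n * ((real k + 2) * (real k + 1 + real n) / (2 * real k + 3) * q k n)"
  \<comment> \<open>At n = l the index (l - 1, m) is inadmissible and \<open>sph_theta_eq\<close>
    does not apply; both sides are 0 for separate reasons.\<close>
  proof (cases "n = l")
    case True
    then have "b_coef t l m = 0" using m2 by (simp add: b_coef_def)
    moreover have "q k n = 0" 
      using True Suc by (simp add: q_def higher_pderiv_legendre_poly_eq_0 del: funpow.simps)
    ultimately show ?thesis by simp
  next
    case False
    then have nk: "n \<le> k" using nl Suc by simp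
    have "b_coef t l m * sph_norm k n = (real k + 2) * (real k + 1 + real n) / (2 * real k + 3) * sph_norm l n"
      \<comment> \<open>The bound by \<open>t\<close> keeps \<open>b_coef\<close> out of its zero
        convention.\<close>
      using sqrt_mult_sph_norm_lower[OF nk] m2 \<open>l \<le> t\<close> unfolding b_coef_def Suc by simp
    moreover have "sph_theta (l - 1) m \<theta> = sph_norm k n * (\<sigma> * sin \<theta> ^ n * q k n)"
      using assms nk Suc by (simp add: sph_theta_eq \<sigma>_def q_def)
    ultimately show ?thesis by (simp only: mult.assoc[symmetric]) (simp only: mult_ac)
  qed
  have "real n * cos \<theta> * q l n - (sin \<theta>)\<^sup>2 * q l (Suc n)
     = (real k + 1) * (real k + 2 - real n) / (2 * real k + 3) * q (Suc l) n
       - (real k + 2) * (real k + 1 + real n) / (2 * real k + 3) * q k n"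
    using rec by (simp add: divide_simps mult_ac)
  then show ?thesis
    unfolding up down unfolding q_def[symmetric] \<sigma>_def[symmetric] by (simp only: right_diff_distrib)
qed

section \<open>Derivatives of the spherical harmonics\<close>

lemma has_real_derivative_sph_theta:
  assumes "\<bar>m\<bar> \<le> int l" "l \<le> t" "0 < sin \<theta>"
  shows "(sph_theta l m has_real_derivative
           (a_coef (int l) m * sph_theta (Suc l) m \<theta> - b_coef t l m * sph_theta (l - 1) m \<theta>) / sin \<theta>)
         (at \<theta>)"
proof -
  define n where "n = nat \<bar>m\<bar>"
  define c where "c = (if 0 \<le> m then (-1) ^ nat m else 1) * sph_norm l n"
  define p where "p = (pderiv ^^ n) (legendre_poly l)"
  have "((\<lambda>\<theta>. c * sin \<theta> ^ n * poly p (cos \<theta>)) has_real_derivative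
     c * (real n * sin \<theta> ^ (n - 1) * cos \<theta> * poly p (cos \<theta>) - sin \<theta> ^ n * (sin \<theta> * poly (pderiv p) (cos \<theta>))))
     (at \<theta>)"
    by (auto intro!: derivative_eq_intros simp: algebra_simps)
  \<comment> \<open>Extracts 1 / sin \<open>\<theta>\<close>; for n = 0 the truncated exponent is
    harmless because of the factor \<open>real n\<close>.\<close>
  moreover have "c * (real n * sin \<theta> ^ (n - 1) * cos \<theta> * poly p (cos \<theta>) - sin \<theta> ^ n * (sin \<theta> * poly (pderiv p) (cos \<theta>)))
     = c * sin \<theta> ^ n * (real n * cos \<theta> * poly p (cos \<theta>) - (sin \<theta>)\<^sup>2 * poly (pderiv p) (cos \<theta>)) / sin \<theta>"
    using assms by (cases n) (auto simp: field_simps power2_eq_square)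
  ultimately have "((\<lambda>\<theta>. c * sin \<theta> ^ n * poly p (cos \<theta>)) has_real_derivative
     (a_coef (int l) m * sph_theta (Suc l) m \<theta> - b_coef t l m * sph_theta (l - 1) m \<theta>) / sin \<theta>) (at \<theta>)"
    using sin_sph_theta_recurrence[OF assms]
    unfolding n_def[symmetric] c_def p_def by simp
  \<comment> \<open>The closed form has the absolute value of the sine; it agrees with the function
    just differentiated on the open set where the sine is positive.\<close>
  then show ?thesis
  proof (rule has_field_derivative_transform_within_open)
    show "open {x::real. 0 < sin x}"
      by (intro open_Collect_less continuous_intros)
  qed (use assms in \<open>auto simp: sph_theta_eq c_def n_def p_def\<close>)
qed

text \<open>Product rule. The neighbouring degrees carry the same \<open>m\<close>, so the common
  exponential factor turns their polar factors back into spherical harmonics.\<close>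

lemma has_derivative_sph_harm:
  fixes X :: "(real ^ 'n) \<times> (real ^ 'n)"
  assumes "\<bar>m\<bar> \<le> int l" "l \<le> t" "0 < sin (fst X $ i)"
  shows "((\<lambda>X. sph_harm l m (fst X $ i) (snd X $ i)) has_derivative
           (\<lambda>h. of_real (fst h $ i) *
                  ((a_coef (int l) m * sph_harm (Suc l) m (fst X $ i) (snd X $ i)
                    - b_coef t l m * sph_harm (l - 1) m (fst X $ i) (snd X $ i)) / sin (fst X $ i))
                + of_real (snd h $ i) * (\<i> * of_int m * sph_harm l m (fst X $ i) (snd X $ i))))
         (at X)"
proof -
  define D where "D = (a_coef (int l) m * sph_theta (Suc l) m (fst X $ i)
                    - b_coef t l m * sph_theta (l - 1) m (fst X $ i)) / sin (fst X $ i)"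
  have nth: "((\<lambda>v. v $ i) has_derivative (\<lambda>h. h $ i)) F" for F :: "(real ^ 'n) filter"
    by (rule bounded_linear_imp_has_derivative) (rule bounded_linear_vec_nth)
  have f: "((\<lambda>X. fst X $ i) has_derivative (\<lambda>h. fst h $ i)) (at X)"
    by (rule has_derivative_compose[OF has_derivative_fst[OF has_derivative_ident] nth])
  have s: "((\<lambda>X. snd X $ i) has_derivative (\<lambda>h. snd h $ i)) (at X)"
    by (rule has_derivative_compose[OF has_derivative_snd[OF has_derivative_ident] nth])
  have g: "((\<lambda>X. sph_theta l m (fst X $ i)) has_derivative (\<lambda>h. D * fst h $ i)) (at X)"
    using has_derivative_compose[OF f has_real_derivative_sph_theta[OF assms, unfolded has_field_derivative_def]]
    by (simp add: D_def)
  have e: "((\<lambda>X. exp (\<i> * of_int m * complex_of_real (snd X $ i))) has_derivative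
      (\<lambda>h. of_real (snd h $ i) * (\<i> * of_int m * exp (\<i> * of_int m * complex_of_real (snd X $ i))))) (at X)"
    using has_derivative_compose[OF has_derivative_mult_right[OF has_derivative_of_real[OF s], of "\<i> * of_int m"]
        DERIV_exp[unfolded has_field_derivative_def]]
    by (simp add: mult_ac)
  show ?thesis
    unfolding sph_harm_eq_sph_theta
    by (rule has_derivative_eq_rhs[OF has_derivative_mult[OF has_derivative_of_real[OF g] e]])
      (auto simp: fun_eq_iff D_def field_simps diff_divide_distrib)
qed

section \<open>Shifting the degree in sums over the index set\<close>

lemma finite_harm_index: "finite (harm_index t)"
proof (rule finite_subset)
  show "harm_index t \<subseteq> {..t} \<times> {- int t..int t}" by (auto simp: harm_index_def)
qed simp

lemma sum_harm_index_shift: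
  fixes Y C :: "nat \<Rightarrow> int \<Rightarrow> complex"
  shows "(\<Sum>(l, m)\<in>harm_index (t + 1).
            Y l m * (C (l - 1) m * a_coef (int l - 1) m - C (l + 1) m * b_coef t (l + 1) m))
       = (\<Sum>(l, m)\<in>harm_index t.
            C l m * (a_coef (int l) m * Y (Suc l) m - b_coef t l m * Y (l - 1) m))"
proof -
  have a0: "a_coef (int l - 1) m = 0" and b0: "b_coef t l m = 0" if "\<bar>m\<bar> = int l" for l m
  proof -
    have "(real_of_int m)\<^sup>2 = (real l)\<^sup>2"
      using that by (metis of_int_abs of_int_of_nat_eq power2_abs)
    then show "a_coef (int l - 1) m = 0" "b_coef t l m = 0"
      by (simp_all add: a_coef_def b_coef_def)
  qed
  have a: "(\<Sum>(l, m)\<in>harm_index (t + 1). Y l m * (C (l - 1) m * a_coef (int l - 1) m))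
       = (\<Sum>(l, m)\<in>harm_index t. C l m * (a_coef (int l) m * Y (Suc l) m))"
  \<comment> \<open>Exactly the indices with \<open>\<bar>m\<bar> = l\<close> have no admissible
    partner of degree l - 1, and \<open>a0\<close> kills their terms.\<close>
  proof (rule sum.reindex_bij_witness_not_neutral[where S' = "{(l, m) \<in> harm_index (t + 1). \<bar>m\<bar> = int l}"
          and T' = "{}" and i = "\<lambda>(l, m). (Suc l, m)" and j = "\<lambda>(l, m). (l - 1, m)"], goal_cases)
    case 1
    show ?case by (rule finite_subset[OF _ finite_harm_index]) auto
  next
    case (9 p)
    then show ?case
      by (cases p; cases "fst p") (auto simp: a_coef_def)
  qed (auto simp: harm_index_def a0)
  have b: "(\<Sum>(l, m)\<in>harm_index (t + 1). Y l m * (C (l + 1) m * b_coef t (l + 1) m))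
       = (\<Sum>(l, m)\<in>harm_index t. C l m * (b_coef t l m * Y (l - 1) m))"
  \<comment> \<open>The top degrees t and t + 1 vanish by the convention on \<open>b_coef\<close>;
    on the other side the unmatched indices vanish by \<open>b0\<close>.\<close>
  proof (rule sum.reindex_bij_witness_not_neutral[where S' = "{(l, m) \<in> harm_index (t + 1). t \<le> l}"
          and T' = "{(l, m) \<in> harm_index t. \<bar>m\<bar> = int l}"
          and i = "\<lambda>(l, m). (l - 1, m)" and j = "\<lambda>(l, m). (Suc l, m)"], goal_cases)
    case 1
    show ?case by (rule finite_subset[OF _ finite_harm_index]) auto
  next
    case 2
    show ?case by (rule finite_subset[OF _ finite_harm_index]) auto
  next
    case (7 p)
    then show ?case by (auto simp: harm_index_def b_coef_def le_Suc_eq)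
  qed (auto simp: harm_index_def b0)
  show ?thesis
    using a b by (simp add: case_prod_unfold right_diff_distrib sum_subtractf)
qed

section \<open>The gradient of \<open>A_fun\<close> as sums\<close>

lemma Re_of_real_mult: "Re (of_real a * z) = a * Re z"
  by simp

lemma GDERIV_A_fun:
  fixes X :: "(real ^ 'n) \<times> (real ^ 'n)"
  assumes "\<And>i. 0 < sin (fst X $ i)"
  shows "GDERIV (A_fun t) X :>
     (\<chi> i. 8 * pi / (real CARD('n))\<^sup>2 *
            Re ((\<Sum>(l, m)\<in>harm_index t. c_hat X l m *
                 (a_coef (int l) m * sph_harm (Suc l) m (fst X $ i) (snd X $ i)
                   - b_coef t l m * sph_harm (l - 1) m (fst X $ i) (snd X $ i))) / sin (fst X $ i)),
      \<chi> i. 8 * pi / (real CARD('n))\<^sup>2 *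
            Re (\<Sum>(l, m)\<in>harm_index t. c_hat X l m *
                 (\<i> * of_int m * sph_harm l m (fst X $ i) (snd X $ i))))"
proof -
  define c where "c = 4 * pi / (real CARD('n))\<^sup>2"
  define S where "S l m X = (\<Sum>i\<in>UNIV. sph_harm l m (fst X $ i) (snd X $ i))"
    for l m and X :: "(real ^ 'n) \<times> (real ^ 'n)"
  define u v where
    "u l m i = (a_coef (int l) m * sph_harm (Suc l) m (fst X $ i) (snd X $ i)
                   - b_coef t l m * sph_harm (l - 1) m (fst X $ i) (snd X $ i)) / sin (fst X $ i)"
    and "v l m i = \<i> * of_int m * sph_harm l m (fst X $ i) (snd X $ i)" for l m i
  define S' where "S' l m h = (\<Sum>i\<in>UNIV. of_real (fst h $ i) * u l m i + of_real (snd h $ i) * v l m i)"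
    for l m and h :: "(real ^ 'n) \<times> (real ^ 'n)"
  have cnj_S: "cnj (S l m X) = c_hat X l m" for l m
    by (simp add: S_def c_hat_def)
  have S: "(S l m has_derivative S' l m) (at X)" if "(l, m) \<in> harm_index t" for l m
    unfolding S_def S'_def u_def v_def using that assms
    by (intro has_derivative_sum has_derivative_sph_harm) (auto simp: harm_index_def)
  \<comment> \<open>Squared moduli become real inner products on the complex plane, for which a
    product rule holds; its two equal terms turn 4 pi into 8 pi.\<close>
  have A: "A_fun t = (\<lambda>X. c * (\<Sum>(l, m)\<in>harm_index t. S l m X \<bullet> S l m X) - 1)"
    by (intro ext) (simp add: A_fun_def c_def S_def power2_norm_eq_inner)
  have "(A_fun t has_derivative
           (\<lambda>h. c * (\<Sum>(l, m)\<in>harm_index t. S l m X \<bullet> S' l m h + S' l m h \<bullet> S l m X) - 0)) (at X)"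
    unfolding A case_prod_unfold
    by (intro has_derivative_diff has_derivative_mult_right has_derivative_sum has_derivative_inner
        has_derivative_const S) auto
  moreover have "c * (\<Sum>(l, m)\<in>harm_index t. S l m X \<bullet> S' l m h + S' l m h \<bullet> S l m X) - 0
     = h \<bullet> (\<chi> i. 2 * c * Re (\<Sum>(l, m)\<in>harm_index t. c_hat X l m * u l m i),
            \<chi> i. 2 * c * Re (\<Sum>(l, m)\<in>harm_index t. c_hat X l m * v l m i))" for h
  proof -
    have "S l m X \<bullet> S' l m h = (\<Sum>i\<in>UNIV. fst h $ i * Re (c_hat X l m * u l m i)
                                    + snd h $ i * Re (c_hat X l m * v l m i))" for l m
    proof -
      have "S l m X \<bullet> S' l m h = Re (c_hat X l m * S' l m h)"
        by (simp add: inner_complex_def flip: cnj_S)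
      also have "c_hat X l m * S' l m h = (\<Sum>i\<in>UNIV. of_real (fst h $ i) * (c_hat X l m * u l m i)
                                    + of_real (snd h $ i) * (c_hat X l m * v l m i))"
        unfolding S'_def sum_distrib_left by (intro sum.cong) (simp_all add: algebra_simps)
      finally show ?thesis by (simp only: Re_sum plus_complex.sel Re_of_real_mult)
    qed
    then have "c * (\<Sum>(l, m)\<in>harm_index t. S l m X \<bullet> S' l m h + S' l m h \<bullet> S l m X)
      = 2 * c * (\<Sum>(l, m)\<in>harm_index t. \<Sum>i\<in>UNIV. fst h $ i * Re (c_hat X l m * u l m i)
                                    + snd h $ i * Re (c_hat X l m * v l m i))"
      by (simp add: inner_commute case_prod_unfold flip: sum_distrib_left)
    also have "\<dots> = 2 * c * (\<Sum>i\<in>UNIV. fst h $ i * Re (\<Sum>(l, m)\<in>harm_index t. c_hat X l m * u l m i)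
                 + snd h $ i * Re (\<Sum>(l, m)\<in>harm_index t. c_hat X l m * v l m i))"
      \<comment> \<open>Exchanging the sums collects the coefficient of each coordinate of
        \<open>h\<close>, from which the gradient is read off.\<close>
      unfolding case_prod_unfold
      by (subst sum.swap) (simp add: sum.distrib sum_distrib_left)
    finally show ?thesis
      by (simp add: inner_prod_def inner_vec_def sum.distrib sum_distrib_left algebra_simps)
  qed
  ultimately show ?thesis
    unfolding gderiv_def u_def v_def c_def
    by (simp add: case_prod_unfold sum_divide_distrib)
qed

section \<open>Matrix-vector form\<close>

theorem theorem2p2:
  fixes t :: nat
    and \<theta> \<phi> :: "real ^ 'n"
    and \<iota> :: "'p::finite \<Rightarrow> nat \<times> int"
    and \<kappa> :: "'q::finite \<Rightarrow> nat \<times> int"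
  assumes "bij_betw \<iota> UNIV (harm_index t)"
    and "bij_betw \<kappa> UNIV (harm_index (t + 1))"
    and "\<forall>i. \<theta> $ i \<in> {0..pi} \<and> \<phi> $ i \<in> {0..<2 * pi}"
  shows "A_fun t (\<theta>, \<phi>) =
           4 * pi / (real CARD('n))\<^sup>2
             * (norm (conj_transpose (Y_mat \<iota> (\<theta>, \<phi>)) *v (1 :: complex ^ 'n)))\<^sup>2 - 1
       \<and> ((\<forall>i. sin (\<theta> $ i) \<noteq> 0) \<longrightarrow>
            (GDERIV (A_fun t) (\<theta>, \<phi>) :>
               (Re_vec (D_mat \<theta> *v (Y_mat \<kappa> (\<theta>, \<phi>) *v c0_vec t \<kappa> (\<theta>, \<phi>))),
                Re_vec (Y_mat \<iota> (\<theta>, \<phi>) *v d0_vec \<iota> (\<theta>, \<phi>)))))"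
proof (intro conjI impI)
  let ?X = "(\<theta>, \<phi>)"
  define c where "c = 8 * pi / (real CARD('n))\<^sup>2"
  note sum_\<iota> = sum.reindex_bij_betw[OF assms(1)] and sum_\<kappa> = sum.reindex_bij_betw[OF assms(2)]
  have "(norm (conj_transpose (Y_mat \<iota> ?X) *v (1 :: complex ^ 'n)))\<^sup>2
      = (\<Sum>p\<in>UNIV. (case \<iota> p of (l, m) \<Rightarrow> (cmod (c_hat ?X l m))\<^sup>2))"
    unfolding norm_vec_def L2_set_def
    by (auto simp: sum_nonneg conj_transpose_def Y_mat_def matrix_vector_mult_def c_hat_def
        intro!: sum.cong split: prod.splits)
  also have "\<dots> = (\<Sum>(l, m)\<in>harm_index t. (cmod (c_hat ?X l m))\<^sup>2)"
    by (rule sum_\<iota>)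
  also have "\<dots> = (\<Sum>(l, m)\<in>harm_index t. (cmod (\<Sum>i\<in>UNIV. sph_harm l m (\<theta> $ i) (\<phi> $ i)))\<^sup>2)"
    by (simp add: c_hat_def flip: cnj_sum)
  finally show "A_fun t ?X = 4 * pi / (real CARD('n))\<^sup>2
             * (norm (conj_transpose (Y_mat \<iota> ?X) *v (1 :: complex ^ 'n)))\<^sup>2 - 1"
    by (simp add: A_fun_def)
  assume nz: "\<forall>i. sin (\<theta> $ i) \<noteq> 0"
  \<comment> \<open>On [0, pi] the sine is nonnegative, so nonvanishing means positive.\<close>
  have pos: "0 < sin (fst ?X $ i)" for i
    using nz assms(3) sin_ge_zero[of "\<theta> $ i"] by (simp add: order_less_le)
  have "(Y_mat \<kappa> ?X *v c0_vec t \<kappa> ?X) $ i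
      = (\<Sum>q\<in>UNIV. (case \<kappa> q of (l, m) \<Rightarrow> c * (sph_harm l m (\<theta> $ i) (\<phi> $ i) *
           (c_hat ?X (l - 1) m * a_coef (int l - 1) m - c_hat ?X (l + 1) m * b_coef t (l + 1) m))))" for i
    by (auto simp: Y_mat_def matrix_vector_mult_def c0_vec_def c_def intro!: sum.cong split: prod.splits)
  also have "\<dots> i = c * (\<Sum>(l, m)\<in>harm_index (t + 1). sph_harm l m (\<theta> $ i) (\<phi> $ i) *
           (c_hat ?X (l - 1) m * a_coef (int l - 1) m - c_hat ?X (l + 1) m * b_coef t (l + 1) m))" for i
    by (subst sum_\<kappa>) (simp only: case_prod_unfold sum_distrib_left)
  \<comment> \<open>The shift of degree passes from the coefficients to the harmonics, which gives
    the form produced by differentiation.\<close>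
  also have "\<dots> i = c * (\<Sum>(l, m)\<in>harm_index t. c_hat ?X l m *
           (a_coef (int l) m * sph_harm (Suc l) m (\<theta> $ i) (\<phi> $ i)
             - b_coef t l m * sph_harm (l - 1) m (\<theta> $ i) (\<phi> $ i)))" for i
    unfolding sum_harm_index_shift[where Y = "\<lambda>l m. sph_harm l m (\<theta> $ i) (\<phi> $ i)" and C = "c_hat ?X"] ..
  finally have Yc: "(Y_mat \<kappa> ?X *v c0_vec t \<kappa> ?X) $ i = \<dots> i" for i .
  have D: "(D_mat \<theta> *v w) $ i = w $ i / sin (\<theta> $ i)" for w :: "complex ^ 'n" and i
    by (simp add: D_mat_def matrix_vector_mult_def if_distrib[of "\<lambda>x. x * _"] cong: if_cong)
  have "(Y_mat \<iota> ?X *v d0_vec \<iota> ?X) $ i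
      = (\<Sum>p\<in>UNIV. (case \<iota> p of (l, m) \<Rightarrow> c * (c_hat ?X l m * (\<i> * of_int m * sph_harm l m (\<theta> $ i) (\<phi> $ i)))))" for i
    by (auto simp: Y_mat_def matrix_vector_mult_def d0_vec_def c_def intro!: sum.cong split: prod.splits)
  also have "\<dots> i = c * (\<Sum>(l, m)\<in>harm_index t. c_hat ?X l m * (\<i> * of_int m * sph_harm l m (\<theta> $ i) (\<phi> $ i)))" for i
    by (subst sum_\<iota>) (simp only: case_prod_unfold sum_distrib_left)
  finally have Yd: "(Y_mat \<iota> ?X *v d0_vec \<iota> ?X) $ i = \<dots> i" for i .
  have "Re_vec (D_mat \<theta> *v (Y_mat \<kappa> ?X *v c0_vec t \<kappa> ?X)) =
     (\<chi> i. c * Re ((\<Sum>(l, m)\<in>harm_index t. c_hat ?X l m *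
                 (a_coef (int l) m * sph_harm (Suc l) m (fst ?X $ i) (snd ?X $ i)
                   - b_coef t l m * sph_harm (l - 1) m (fst ?X $ i) (snd ?X $ i))) / sin (fst ?X $ i)))"
    unfolding vec_eq_iff Re_vec_def D Yc
    by (simp only: vec_lambda_beta fst_conv snd_conv times_divide_eq_right[symmetric] Re_of_real_mult simp_thms)
  moreover have "Re_vec (Y_mat \<iota> ?X *v d0_vec \<iota> ?X) =
     (\<chi> i. c * Re (\<Sum>(l, m)\<in>harm_index t. c_hat ?X l m *
                 (\<i> * of_int m * sph_harm l m (fst ?X $ i) (snd ?X $ i))))"
    unfolding vec_eq_iff Re_vec_def Yd
    by (simp only: vec_lambda_beta fst_conv snd_conv Re_of_real_mult simp_thms)
  ultimately show "GDERIV (A_fun t) ?X :>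
               (Re_vec (D_mat \<theta> *v (Y_mat \<kappa> ?X *v c0_vec t \<kappa> ?X)), Re_vec (Y_mat \<iota> ?X *v d0_vec \<iota> ?X))"
    using GDERIV_A_fun[OF pos] unfolding c_def by simp
qed

end
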